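(* Let $\beta>1$ and let $\mathcal{D}_\beta$ be the distribution on $[0,\infty)$ with density $f_\beta(z) = C_\beta e^{-z^\beta}$ for $z\ge 0$ (and $0$ for $z<0$), where $C_\beta$ is the normalizing constant. Then for every $\epsilon>0$, GBPA with the stochastically smoothed potential whose perturbation is $\eta Z$, $Z\sim\mathcal{D}_\beta$, with an appropriate choice of scale $\eta>0$ (depending on $N$ and $T$), has expected regret $O\big((TN)^{1/2+\epsilon}\big)$ uniformly over gain sequences $g_1,\dots,g_T\in[-1,0]^N$.
   Context: Adversarial multi-armed bandit: $N$ arms, $T$ rounds; an oblivious adversary fixes $g_1,\dots,g_T \in [-1,0]^N$ in advance. For a random variable $W$ with a continuous distribution and finite expectation, the stochastically smoothed potential is $\tilde\Phi(G) = \mathbb{E}[\max_{i}(G_i + W_i)]$, $W_1,\dots,W_N$ i.i.d. copies of $W$; $\nabla_i\tilde\Phi(G) = \mathbb{P}(i = \arg\max_j (G_j+W_j))$. "Perturbation $\eta Z$" means $W=\eta Z$. GBPA$(\tilde\Phi)$: $\hat G_0 = 0$; for $t=1,\dots,T$: $p_t = \nabla\tilde\Phi(\hat G_{t-1})$, draw $i_t \sim p_t$, observe only $g_{t,i_t}$, set $\hat g_t = \frac{g_{t,i_t}}{p_{t,i_t}} e_{i_t}$, $\hat G_t = \hat G_{t-1} + \hat g_t$. Expected regret: $\mathbb{E}\big[\max_{i}\sum_{t=1}^T (g_{t,i} - g_{t,i_t})\big]$ over the learner's randomness. Constants in $O(\cdot)$ depend on $\beta,\epsilon$ only. *)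

theory Defs
  imports "HOL-Probability.Probability"
begin

text \<open>Arms are the naturals 0,...,N-1; rounds are 1,...,T.
  Gain vectors and cumulative (estimated) gain vectors are functions nat => real,
  only their values on arms below N matter.\<close>

definition C_beta :: "real \<Rightarrow> real" where
  "C_beta \<beta> = 1 / (LBINT z:{0..}. exp (- (z powr \<beta>)))"

definition D_beta :: "real \<Rightarrow> real measure" where
  "D_beta \<beta> = density lborel
     (\<lambda>z. ennreal (if 0 \<le> z then C_beta \<beta> * exp (- (z powr \<beta>)) else 0))"

text \<open>Gradient of the stochastically smoothed potential with perturbation W = eta Z,
  Z ~ D_beta, N i.i.d. copies: probability that arm i is the argmax of G_j + eta Z_j.\<close>
definition smooth_grad :: "real \<Rightarrow> real \<Rightarrow> nat \<Rightarrow> (nat \<Rightarrow> real) \<Rightarrow> nat \<Rightarrow> real" where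
  "smooth_grad \<beta> \<eta> N G i =
     measure (PiM {..<N} (\<lambda>_. D_beta \<beta>))
       {w \<in> space (PiM {..<N} (\<lambda>_. D_beta \<beta>)).
          \<forall>j<N. j \<noteq> i \<longrightarrow> G j + \<eta> * w j < G i + \<eta> * w i}"

fun gbpa_est :: "real \<Rightarrow> real \<Rightarrow> nat \<Rightarrow> (nat \<Rightarrow> nat \<Rightarrow> real) \<Rightarrow> (nat \<Rightarrow> nat) \<Rightarrow> nat
                   \<Rightarrow> (nat \<Rightarrow> real)" where
  "gbpa_est \<beta> \<eta> N g I 0 = (\<lambda>_. 0)"
| "gbpa_est \<beta> \<eta> N g I (Suc t) =
     (let G = gbpa_est \<beta> \<eta> N g I t;
          p = smooth_grad \<beta> \<eta> N G (I (Suc t))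
      in (\<lambda>j. G j + (if j = I (Suc t) then g (Suc t) (I (Suc t)) / p else 0)))"

text \<open>Expected regret of GBPA over the learner's randomness: sum over all sequences of
  drawn arms, weighted by the probability of the sequence
  (product of p_{t,i_t} with p_t = grad Phi(hat G_{t-1})).\<close>
definition gbpa_expected_regret ::
  "real \<Rightarrow> real \<Rightarrow> nat \<Rightarrow> nat \<Rightarrow> (nat \<Rightarrow> nat \<Rightarrow> real) \<Rightarrow> real" where
  "gbpa_expected_regret \<beta> \<eta> N T g =
     (\<Sum>I\<in>PiE {1..T} (\<lambda>_. {..<N}).
        (\<Prod>t\<in>{1..T}. smooth_grad \<beta> \<eta> N (gbpa_est \<beta> \<eta> N g I (t - 1)) (I t))
        * Max ((\<lambda>i. \<Sum>t\<in>{1..T}. g t i - g t (I t)) ` {..<N}))"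

end

theory Submission
  imports Defs
begin

text \<open>
  The density \<open>f\<close> of \<open>D_beta \<beta>\<close> has an unbounded hazard rate, which however grows only polynomially, so
  \<open>f x \<le> B * P(Z > x) powr (1 - \<delta>)\<close> for every \<open>\<delta> > 0\<close>. Write \<open>p\<close> for the probability of arm \<open>i\<close>
  under the current estimate \<open>G\<close>. Lowering the estimate of arm \<open>i\<close> by \<open>s \<le> 1 / p\<close> lowers the potential
  by \<open>s * p\<close> up to an error of at most \<open>s\<close> times the probability that arm \<open>i\<close> leads by less than \<open>s\<close>.
  That probability is at most \<open>p\<close>, and conditioning on the other perturbations it is also
  of order \<open>(s / \<eta>) * p powr (1 - \<delta>)\<close>. The first bound is used when \<open>p \<le> 1 / \<eta>\<close> and the second otherwise,
  so arm \<open>i\<close> contributes at most order \<open>\<eta> powr (\<delta> - 1)\<close> per round to the expected growth of the potential,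
  however small \<open>p\<close> is. Summing over arms and rounds, the regret is of order
  \<open>\<eta> * E (max Z) + T * N * \<eta> powr (\<delta> - 1)\<close> with \<open>E (max Z) = O(ln N)\<close> for \<open>N \<ge> 2\<close>, and
  \<open>\<eta> = sqrt (T * N)\<close> gives the claim.
\<close>

section \<open>The distribution\<close>

lemma powr_ge_minus_one:
  fixes z \<beta> :: real
  assumes "0 \<le> z" "1 \<le> \<beta>"
  shows "z - 1 \<le> z powr \<beta>"
proof (cases "z \<le> 1")
  case False
  then have "z powr 1 \<le> z powr \<beta>"
    using assms by (intro powr_mono) auto
  then show ?thesis using False by simp
next
  case True
  then show ?thesis by (smt (verit) powr_ge_zero)
qed

lemma integrable_exp_Ici:
  fixes l :: real
  assumes "0 < l"
  shows "integrable lborel (\<lambda>z. if 0 \<le> z then exp (- (l * z)) else 0)"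
proof -
  interpret prob_space "density lborel (exponential_density l)"
    by (rule prob_space_exponential_density) fact
  have "(\<integral>\<^sup>+z. ennreal (exponential_density l z) \<partial>lborel) = 1"
    using emeasure_space_1 by (simp add: emeasure_density)
  then have "integrable lborel (exponential_density l)"
    using assms by (intro integrableI_nn_integral_finite[where x = 1])
      (auto intro!: AE_I2 simp: exponential_density_def erlang_density_def)
  then have "integrable lborel (\<lambda>z. exponential_density l z / l)"
    by simp
  moreover have "(\<lambda>z. exponential_density l z / l) = (\<lambda>z. if 0 \<le> z then exp (- (l * z)) else 0)"
    using assms by (auto simp: exponential_density_def erlang_density_def mult.commute)
  ultimately show ?thesis by simp
qed

text \<open>By \<open>powr_ge_minus_one\<close> the integrand is, up to the factor
  \<open>exp 1\<close>, below an exponential of rate \<open>1 - c\<close>. The case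
  \<open>c = 0\<close> serves the normalising constant; \<open>c = 1/2\<close> gives the exponential
  moment used for the mean and for the logarithmic bound on the maximum.\<close>

lemma integrable_exp_powr_Ici:
  fixes \<beta> c :: real
  assumes "1 \<le> \<beta>" "c < 1"
  shows "integrable lborel (\<lambda>z. if 0 \<le> z then exp (c * z - z powr \<beta>) else 0)"
proof (rule Bochner_Integration.integrable_bound)
  show "integrable lborel (\<lambda>z. exp 1 * (if 0 \<le> z then exp (- ((1 - c) * z)) else 0))"
    using integrable_exp_Ici[of "1 - c"] assms by simp
  have "exp (c * z - z powr \<beta>) \<le> exp 1 * exp (- ((1 - c) * z))" if "0 \<le> z" for z
    unfolding exp_add[symmetric] using powr_ge_minus_one[OF that assms(1)]
    by (simp add: algebra_simps)
  then show "AE z in lborel. norm (if 0 \<le> z then exp (c * z - z powr \<beta>) else 0)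
      \<le> norm (exp 1 * (if 0 \<le> z then exp (- ((1 - c) * z)) else 0))"
    by (auto intro!: AE_I2)
qed simp

text \<open>The integrand is at least \<open>exp (-1)\<close> on the unit interval. Positivity
  ensures that \<open>C_beta\<close> is a genuine reciprocal and not the default value of a division
  by zero.\<close>

lemma exp_powr_integral_pos:
  fixes \<beta> :: real
  assumes "1 \<le> \<beta>"
  shows "0 < (\<integral>z. (if 0 \<le> z then exp (- (z powr \<beta>)) else 0) \<partial>lborel)"
proof -
  have "exp (-1) * (\<integral>z. indicator {0..1::real} z \<partial>lborel)
      \<le> (\<integral>z. (if 0 \<le> z then exp (- (z powr \<beta>)) else 0) \<partial>lborel)"
    unfolding integral_mult_right_zero[symmetric]
  proof (rule integral_mono)
    show "integrable lborel (\<lambda>z. exp (-1) * indicator {0..1::real} z :: real)"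
      by simp
    show "integrable lborel (\<lambda>z. if 0 \<le> z then exp (- (z powr \<beta>)) else 0)"
      using integrable_exp_powr_Ici[OF assms, of 0] by (simp cong: if_cong)
    show "exp (-1) * indicator {0..1} z \<le> (if 0 \<le> z then exp (- (z powr \<beta>)) else 0)" for z
      using assms powr_mono2[of \<beta> z 1] by (auto split: split_indicator)
  qed
  moreover have "(\<integral>z. indicator {0..1::real} z \<partial>lborel) = (1::real)"
    by simp
  ultimately show ?thesis
    by (smt (verit) exp_gt_zero mult_cancel_left1 mult.right_neutral)
qed

definition f_beta :: "real \<Rightarrow> real \<Rightarrow> real" where
  "f_beta \<beta> z = (if 0 \<le> z then C_beta \<beta> * exp (- (z powr \<beta>)) else 0)"

lemma D_beta_eq_density: "D_beta \<beta> = density lborel (\<lambda>z. ennreal (f_beta \<beta> z))"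
  by (simp add: D_beta_def f_beta_def)

lemma C_beta_eq: "C_beta \<beta> = 1 / (\<integral>z. (if 0 \<le> z then exp (- (z powr \<beta>)) else 0) \<partial>lborel)"
  unfolding C_beta_def set_lebesgue_integral_def
  by (intro arg_cong2[where f = "(/)"] Bochner_Integration.integral_cong) (auto split: split_indicator)

lemma C_beta_pos: "1 \<le> \<beta> \<Longrightarrow> 0 < C_beta \<beta>"
  unfolding C_beta_eq using exp_powr_integral_pos by simp

lemma f_beta_nonneg: "1 \<le> \<beta> \<Longrightarrow> 0 \<le> f_beta \<beta> z"
  using C_beta_pos[of \<beta>] by (simp add: f_beta_def)

lemma measurable_f_beta [measurable]: "f_beta \<beta> \<in> borel_measurable borel"
  unfolding f_beta_def by measurable

lemma sets_D_beta [simp, measurable_cong]: "sets (D_beta \<beta>) = sets borel"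
  by (simp add: D_beta_def)

lemma space_D_beta [simp]: "space (D_beta \<beta>) = UNIV"
  by (simp add: D_beta_def)

lemma prob_space_D_beta:
  assumes "1 \<le> \<beta>"
  shows "prob_space (D_beta \<beta>)"
proof (rule prob_spaceI)
  let ?e = "\<lambda>z. if 0 \<le> z then exp (- (z powr \<beta>)) else (0::real)"
  have int: "integrable lborel ?e"
    using integrable_exp_powr_Ici[OF assms, of 0] by (simp cong: if_cong)
  have eq: "f_beta \<beta> = (\<lambda>z. C_beta \<beta> * ?e z)"
    by (auto simp: f_beta_def)
  have "(\<integral>z. f_beta \<beta> z \<partial>lborel) = 1"
    using exp_powr_integral_pos[OF assms] unfolding eq
    by (subst integral_mult_right_zero) (simp add: C_beta_eq)
  moreover have "integrable lborel (f_beta \<beta>)"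
    unfolding eq by (rule integrable_mult_right[OF int])
  ultimately have "(\<integral>\<^sup>+z. ennreal (f_beta \<beta> z) \<partial>lborel) = 1"
    by (subst nn_integral_eq_integral) (auto simp: f_beta_nonneg assms)
  then show "emeasure (D_beta \<beta>) (space (D_beta \<beta>)) = 1"
    by (simp add: D_beta_eq_density emeasure_density)
qed

lemma AE_D_beta_nonneg: "AE z in D_beta \<beta>. 0 \<le> z"
  unfolding D_beta_eq_density by (subst AE_density) (auto simp: f_beta_def)

lemma emeasure_D_beta_singleton [simp]: "emeasure (D_beta \<beta>) {a} = 0"
  unfolding D_beta_eq_density
  by (simp add: emeasure_density nn_integral_0_iff_AE AE_lborel_singleton)

lemma integrable_exp_D_beta:
  assumes "1 \<le> \<beta>" "c < 1"
  shows "integrable (D_beta \<beta>) (\<lambda>z. exp (c * z))"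
proof -
  have "integrable lborel (\<lambda>z. C_beta \<beta> * (if 0 \<le> z then exp (c * z - z powr \<beta>) else 0))"
    by (rule integrable_mult_right[OF integrable_exp_powr_Ici[OF assms]])
  moreover have "(\<lambda>z. C_beta \<beta> * (if 0 \<le> z then exp (c * z - z powr \<beta>) else 0))
      = (\<lambda>z. f_beta \<beta> z *\<^sub>R exp (c * z))"
    by (auto simp: f_beta_def exp_diff exp_minus field_simps)
  ultimately show ?thesis
    unfolding D_beta_eq_density
    by (subst integrable_density) (auto simp: f_beta_nonneg assms)
qed

lemma integrable_id_D_beta:
  assumes "1 \<le> \<beta>"
  shows "integrable (D_beta \<beta>) (\<lambda>z. z)"
proof (rule Bochner_Integration.integrable_bound)
  show "integrable (D_beta \<beta>) (\<lambda>z. 2 * exp ((1/2) * z))"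
    using integrable_exp_D_beta[OF assms, of "1/2"] by simp
  show "AE z in D_beta \<beta>. norm z \<le> norm (2 * exp ((1/2) * z))"
    using AE_D_beta_nonneg
  proof eventually_elim
    case (elim z)
    have "1 + (1/2) * z \<le> exp ((1/2) * z)"
      by (rule exp_ge_add_one_self)
    with elim show ?case by (simp del: exp_ge_add_one_self)
  qed
qed simp

section \<open>Hazard rate and probabilities of short intervals\<close>

lemma f_beta_antimono_on_nonneg:
  assumes "1 \<le> \<beta>" "0 \<le> x" "x \<le> y"
  shows "f_beta \<beta> y \<le> f_beta \<beta> x"
  using assms C_beta_pos[of \<beta>] powr_mono2[of \<beta> x y] by (auto simp: f_beta_def)

text \<open>Mean value theorem: the intermediate point lies below \<open>1 + x\<close> because
  \<open>h \<le> 1\<close>, and the derivative is nondecreasing.\<close>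

lemma powr_diff_le:
  fixes x h \<beta> :: real
  assumes "1 \<le> \<beta>" "0 \<le> x" "0 < h" "h \<le> 1"
  shows "(x + h) powr \<beta> - x powr \<beta> \<le> \<beta> * (1 + x) powr (\<beta> - 1) * h"
proof -
  have der: "((\<lambda>x. x powr \<beta>) has_real_derivative \<beta> * z powr (\<beta> - 1)) (at z)" if "0 < z" for z
    using that by (auto intro!: derivative_eq_intros)
  have "\<exists>l z. x < z \<and> z < x + h \<and> ((\<lambda>x. x powr \<beta>) has_real_derivative l) (at z)
      \<and> (x + h) powr \<beta> - x powr \<beta> = (x + h - x) * l"
  proof (rule MVT)
    show "continuous_on {x..x + h} (\<lambda>x. x powr \<beta>)"
      using assms by (intro continuous_on_powr' continuous_intros) auto
    show "(\<lambda>x. x powr \<beta>) differentiable at z" if "x < z" "z < x + h" for z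
      using der[of z] that assms by (auto simp: real_differentiable_def)
  qed (use assms in auto)
  then obtain l z where z: "x < z" "z < x + h" "((\<lambda>x. x powr \<beta>) has_real_derivative l) (at z)"
      "(x + h) powr \<beta> - x powr \<beta> = h * l"
    by auto
  have "l = \<beta> * z powr (\<beta> - 1)"
    using DERIV_unique[OF z(3) der] z assms by simp
  also have "\<dots> \<le> \<beta> * (1 + x) powr (\<beta> - 1)"
    using z assms by (intro mult_left_mono powr_mono2) auto
  finally show ?thesis
    using z(4) assms by (simp add: mult.commute)
qed

text \<open>Over a window of length \<open>h = (1 + x) powr (1 - \<beta>)\<close> the exponent grows
  by at most \<open>\<beta>\<close>, so the density falls by at most a factor
  \<open>exp \<beta>\<close>. Since the density is nonincreasing there, the tail beyond
  \<open>x\<close> has mass at least \<open>h * f_beta \<beta> (x + h)\<close>.\<close>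

lemma hazard_rate_D_beta_le:
  assumes "1 \<le> \<beta>" "0 \<le> x"
  shows "f_beta \<beta> x \<le> exp \<beta> * (1 + x) powr (\<beta> - 1) * measure (D_beta \<beta>) {x<..}"
proof -
  interpret prob_space "D_beta \<beta>"
    by (rule prob_space_D_beta) fact
  define h where "h = (1 + x) powr (1 - \<beta>)"
  have h: "0 < h" "h \<le> 1"
    using assms powr_mono[of "1 - \<beta>" 0 "1 + x"] by (auto simp: h_def)
  have hinv: "(1 + x) powr (\<beta> - 1) * h = 1"
    using assms by (simp add: h_def powr_add[symmetric])
  have "ennreal (h * f_beta \<beta> (x + h)) = (\<integral>\<^sup>+z. ennreal (f_beta \<beta> (x + h)) * indicator {x<..x+h} z \<partial>lborel)"
    using h by (simp add: ennreal_mult'' mult.commute f_beta_nonneg assms nn_integral_cmult_indicator)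
  also have "\<dots> \<le> (\<integral>\<^sup>+z. ennreal (f_beta \<beta> z) * indicator {x<..} z \<partial>lborel)"
    using assms f_beta_antimono_on_nonneg[of \<beta> _ "x + h"]
    by (intro nn_integral_mono) (auto split: split_indicator intro!: ennreal_leI)
  also have "\<dots> = ennreal (prob {x<..})"
    unfolding emeasure_eq_measure[symmetric] by (simp add: D_beta_eq_density emeasure_density)
  finally have tail: "h * f_beta \<beta> (x + h) \<le> prob {x<..}"
    by simp
  have "(x + h) powr \<beta> - x powr \<beta> \<le> \<beta>"
    using powr_diff_le[OF assms h] hinv by (simp add: mult.assoc)
  then have "exp (- (x powr \<beta>)) \<le> exp \<beta> * exp (- ((x + h) powr \<beta>))"
    unfolding exp_add[symmetric] by simp
  then have "f_beta \<beta> x \<le> exp \<beta> * f_beta \<beta> (x + h)"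
    using assms h C_beta_pos[of \<beta>] mult_left_mono[of "exp (- (x powr \<beta>))" _ "C_beta \<beta>"]
    by (simp add: f_beta_def mult.left_commute)
  also have "\<dots> = exp \<beta> * (1 + x) powr (\<beta> - 1) * (h * f_beta \<beta> (x + h))"
    using hinv by (metis mult.assoc mult_1)
  also have "\<dots> \<le> exp \<beta> * (1 + x) powr (\<beta> - 1) * prob {x<..}"
    using tail by (intro mult_left_mono) auto
  finally show ?thesis .
qed

text \<open>Apply \<open>u \<le> exp u\<close> to \<open>u = d / m * y\<close> and raise to the
  power \<open>m\<close>.\<close>

lemma powr_le_exp:
  fixes y m d :: real
  assumes "0 < y" "0 < m" "0 < d"
  shows "y powr m \<le> (m / d) powr m * exp (d * y)"
proof -
  have "d / m * y \<le> exp (d / m * y)"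
    using exp_ge_add_one_self[of "d / m * y"] by linarith
  then have "y \<le> m / d * exp (d / m * y)"
    using assms by (simp add: field_simps)
  then have "y powr m \<le> (m / d * exp (d / m * y)) powr m"
    using assms by (intro powr_mono2) auto
  also have "\<dots> = (m / d) powr m * exp (d * y)"
    using assms by (subst powr_mult) (simp_all add: exp_powr_real)
  finally show ?thesis .
qed

text \<open>The hazard rate is unbounded, but only polynomially in \<open>x\<close>; a factor \<open>f_beta \<beta> x powr \<delta>\<close>
  absorbs it.\<close>
lemma f_beta_le_tail_powr:
  assumes "1 < \<beta>" "0 < \<delta>" "\<delta> < 1"
  shows "\<exists>B>0. \<forall>x. f_beta \<beta> x \<le> B * measure (D_beta \<beta>) {x<..} powr (1 - \<delta>)"
proof -
  define m where "m = (\<beta> - 1) * (1 - \<delta>)"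
  have m: "0 < m" using assms by (simp add: m_def)
  let ?C = "C_beta \<beta>"
  let ?Q = "\<lambda>x. measure (D_beta \<beta>) {x<..}"
  have C: "0 < ?C" using assms C_beta_pos by simp
  \<comment> \<open>The constants of the two bounds below, multiplied together;
    \<open>exp (2 * \<delta>)\<close> is what remains once the exponentials in \<open>x\<close>
    cancel.\<close>
  define B where "B = ?C powr \<delta> * exp (2 * \<delta>) * exp \<beta> powr (1 - \<delta>) * (m / \<delta>) powr m"
  have B: "0 < B" using C m assms by (simp add: B_def)
  have "f_beta \<beta> x \<le> B * ?Q x powr (1 - \<delta>)" for x
  proof (cases "0 \<le> x")
    case False
    then show ?thesis using B by (simp add: f_beta_def)
  next
    case x: True
    have pos: "0 < f_beta \<beta> x"
      using x C by (simp add: f_beta_def)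
    have "f_beta \<beta> x powr \<delta> = ?C powr \<delta> * exp (- (\<delta> * x powr \<beta>))"
      using x C by (simp add: f_beta_def powr_mult exp_powr_real mult.commute)
    also have "\<dots> \<le> ?C powr \<delta> * (exp \<delta> * exp (- (\<delta> * x)))"
      unfolding exp_add[symmetric]
      using powr_ge_minus_one[of x \<beta>] x assms mult_left_mono[of "x - 1" "x powr \<beta>" \<delta>]
      by (intro mult_left_mono) (auto simp: algebra_simps)
    finally have 1: "f_beta \<beta> x powr \<delta> \<le> ?C powr \<delta> * (exp \<delta> * exp (- (\<delta> * x)))" .
    have "f_beta \<beta> x powr (1 - \<delta>) \<le> (exp \<beta> * (1 + x) powr (\<beta> - 1) * ?Q x) powr (1 - \<delta>)"
      using hazard_rate_D_beta_le[of \<beta> x] x pos assms by (intro powr_mono2) auto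
    also have "\<dots> = exp \<beta> powr (1 - \<delta>) * (1 + x) powr m * ?Q x powr (1 - \<delta>)"
      using x by (simp add: powr_mult powr_powr m_def)
    also have "\<dots> \<le> exp \<beta> powr (1 - \<delta>) * ((m / \<delta>) powr m * exp (\<delta> * (1 + x))) * ?Q x powr (1 - \<delta>)"
      using powr_le_exp[of "1 + x" m \<delta>] x m assms
      by (intro mult_right_mono mult_left_mono) auto
    finally have 2: "f_beta \<beta> x powr (1 - \<delta>)
        \<le> exp \<beta> powr (1 - \<delta>) * ((m / \<delta>) powr m * exp (\<delta> * (1 + x))) * ?Q x powr (1 - \<delta>)" .
    \<comment> \<open>The first factor decays like \<open>exp (- (\<delta> * x))\<close>, which pays
      for the growth \<open>exp (\<delta> * (1 + x))\<close> that replaced the polynomial hazard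
      factor in the second.\<close>
    have "f_beta \<beta> x = f_beta \<beta> x powr \<delta> * f_beta \<beta> x powr (1 - \<delta>)"
      using pos by (simp add: powr_add[symmetric])
    also have "\<dots> \<le> (?C powr \<delta> * (exp \<delta> * exp (- (\<delta> * x))))
        * (exp \<beta> powr (1 - \<delta>) * ((m / \<delta>) powr m * exp (\<delta> * (1 + x))) * ?Q x powr (1 - \<delta>))"
      by (intro mult_mono 1 2) auto
    also have "\<dots> = (exp \<delta> * exp (- (\<delta> * x)) * exp (\<delta> * (1 + x)))
        * (?C powr \<delta> * exp \<beta> powr (1 - \<delta>) * (m / \<delta>) powr m * ?Q x powr (1 - \<delta>))"
      by simp
    also have "exp \<delta> * exp (- (\<delta> * x)) * exp (\<delta> * (1 + x)) = exp (2 * \<delta>)"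
      unfolding exp_add[symmetric] by (simp add: algebra_simps)
    finally show ?thesis
      by (simp add: B_def mult_ac)
  qed
  then show ?thesis using B by blast
qed

text \<open>An affine majorant of a concave power, with a free threshold \<open>t\<close>: below
  \<open>t\<close> the constant suffices, above it \<open>q powr (- \<delta>)\<close> is at most its
  value at \<open>t\<close>. Being affine in \<open>q\<close>, the bound can later be integrated
  over the rivals' noise.\<close>

lemma powr_le_linear:
  fixes q t \<delta> :: real
  assumes "0 \<le> q" "0 < t" "0 < \<delta>" "\<delta> < 1"
  shows "q powr (1 - \<delta>) \<le> t powr (- \<delta>) * q + t powr (1 - \<delta>)"
proof (cases "q \<le> t")
  case True
  then have "q powr (1 - \<delta>) \<le> t powr (1 - \<delta>)"
    using assms by (intro powr_mono2) auto
  moreover have "0 \<le> t powr (- \<delta>) * q"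
    using assms by simp
  ultimately show ?thesis by linarith
next
  case False
  then have "q powr (1 - \<delta>) = q powr (- \<delta>) * q"
    using assms powr_add[of q "- \<delta>" 1] by simp
  also have "\<dots> \<le> t powr (- \<delta>) * q"
    using False assms by (intro mult_right_mono powr_mono2') auto
  finally show ?thesis
    using powr_ge_zero[of t "1 - \<delta>"] by linarith
qed

text \<open>The density is bounded on the whole interval by the tail at its left end. One
  \<open>B\<close> serves all \<open>a\<close>, \<open>u\<close> and \<open>t\<close>, so that
  \<open>t\<close> may later depend on the scale.\<close>

lemma D_beta_interval_le:
  assumes "1 < \<beta>" "0 < \<delta>" "\<delta> < 1"
  shows "\<exists>B>0. \<forall>a u t. 0 \<le> u \<longrightarrow> 0 < t \<longrightarrow>
    measure (D_beta \<beta>) {a<..<a+u}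
      \<le> u * (B * (t powr (- \<delta>) * measure (D_beta \<beta>) {a<..} + t powr (1 - \<delta>)))"
proof -
  interpret prob_space "D_beta \<beta>"
    using assms by (intro prob_space_D_beta) auto
  obtain B where B: "B > 0" "\<And>x. f_beta \<beta> x \<le> B * prob {x<..} powr (1 - \<delta>)"
    using f_beta_le_tail_powr[OF assms] by blast
  have "prob {a<..<a+u} \<le> u * (B * (t powr (- \<delta>) * prob {a<..} + t powr (1 - \<delta>)))"
    if u: "0 \<le> u" and t: "0 < t" for a u t
  proof -
    define K where "K = B * (t powr (- \<delta>) * prob {a<..} + t powr (1 - \<delta>))"
    have K: "0 \<le> K" using B t by (simp add: K_def)
    \<comment> \<open>Monotonicity is taken from the tail, not from the density: the latter jumps up
      at 0, and \<open>a\<close> may be negative.\<close>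
    have fK: "f_beta \<beta> x \<le> K" if "a < x" for x
    proof -
      have "f_beta \<beta> x \<le> B * prob {x<..} powr (1 - \<delta>)" by fact
      also have "\<dots> \<le> B * prob {a<..} powr (1 - \<delta>)"
        using that B assms by (intro mult_left_mono powr_mono2 finite_measure_mono) auto
      also have "\<dots> \<le> K"
        unfolding K_def using B t assms by (intro mult_left_mono powr_le_linear) auto
      finally show ?thesis .
    qed
    have "ennreal (prob {a<..<a+u}) = (\<integral>\<^sup>+z. ennreal (f_beta \<beta> z) * indicator {a<..<a+u} z \<partial>lborel)"
      unfolding emeasure_eq_measure[symmetric] by (simp add: D_beta_eq_density emeasure_density)
    also have "\<dots> \<le> (\<integral>\<^sup>+z. ennreal K * indicator {a<..<a+u} z \<partial>lborel)"
      by (intro nn_integral_mono) (auto split: split_indicator intro!: ennreal_leI fK)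
    also have "\<dots> = ennreal (u * K)"
      using u K by (simp add: nn_integral_cmult_indicator ennreal_mult'' mult.commute)
    finally show ?thesis
      using u K by (simp add: K_def)
  qed
  then show ?thesis using B(1) by blast
qed

section \<open>The smoothed potential\<close>

locale smoothed_potential =
  fixes \<beta> \<eta> :: real and N :: nat
  assumes \<beta>_gt_1: "1 < \<beta>" and \<eta>_pos: "0 < \<eta>" and N_ge_2: "2 \<le> N"
begin

abbreviation noise :: "(nat \<Rightarrow> real) measure" where
  "noise \<equiv> PiM {..<N} (\<lambda>_. D_beta \<beta>)"

definition potential :: "(nat \<Rightarrow> real) \<Rightarrow> real" where
  "potential G = (\<integral>w. Max ((\<lambda>j. G j + \<eta> * w j) ` {..<N}) \<partial>noise)"

text \<open>The value arm \<open>i\<close> has to beat. It does not depend on the coordinate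
  \<open>w i\<close>, hence stays fixed when the other coordinates are conditioned on; two or more
  arms make the maximum range over a nonempty set.\<close>

definition rival :: "(nat \<Rightarrow> real) \<Rightarrow> nat \<Rightarrow> (nat \<Rightarrow> real) \<Rightarrow> real" where
  "rival G i w = Max ((\<lambda>j. G j + \<eta> * w j) ` ({..<N} - {i}))"

sublocale D: prob_space "D_beta \<beta>"
  using \<beta>_gt_1 by (intro prob_space_D_beta) simp

sublocale product_sigma_finite "\<lambda>_::nat. D_beta \<beta>"
  by standard

sublocale noise: prob_space noise
  by (intro prob_space_PiM D.prob_space_axioms)

lemma rivals_nonempty: "{..<N} - {i} \<noteq> {}"
proof -
  have "(if i = 0 then 1 else 0) \<in> {..<N} - {i}"
    using N_ge_2 by auto
  then show ?thesis by blast
qed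

lemma measurable_component:
  "j \<in> J \<Longrightarrow> (\<lambda>w. w j) \<in> borel_measurable (PiM J (\<lambda>_. D_beta \<beta>))"
  using measurable_component_singleton[of j J "\<lambda>_. D_beta \<beta>"]
  by (simp cong: measurable_cong_sets)

lemma measurable_rival:
  assumes "{..<N} - {i} \<subseteq> J"
  shows "rival G i \<in> borel_measurable (PiM J (\<lambda>_. D_beta \<beta>))"
  unfolding rival_def using assms
  by (intro borel_measurable_Max borel_measurable_add borel_measurable_times
      measurable_component borel_measurable_const) auto

lemma measurable_rival_noise [measurable]: "rival G i \<in> borel_measurable noise"
  by (rule measurable_rival) auto

lemma measurable_rival_others [measurable]:
  "rival G i \<in> borel_measurable (PiM ({..<N} - {i}) (\<lambda>_. D_beta \<beta>))"
  by (rule measurable_rival) auto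

lemma Max_eq_max_rival:
  assumes "i < N"
  shows "Max ((\<lambda>j. G j + \<eta> * w j) ` {..<N}) = max (G i + \<eta> * w i) (rival G i w)"
proof -
  have "(\<lambda>j. G j + \<eta> * w j) ` {..<N} = insert (G i + \<eta> * w i) ((\<lambda>j. G j + \<eta> * w j) ` ({..<N} - {i}))"
    using assms by auto
  then show ?thesis
    unfolding rival_def using rivals_nonempty by (simp add: Max_insert)
qed

lemma rival_less_iff:
  "rival G i w < c \<longleftrightarrow> (\<forall>j<N. j \<noteq> i \<longrightarrow> G j + \<eta> * w j < c)"
  unfolding rival_def using rivals_nonempty by (subst Max_less_iff) auto

lemma rival_cong: "(\<And>j. j < N \<Longrightarrow> j \<noteq> i \<Longrightarrow> G j + \<eta> * w j = G' j + \<eta> * w' j) \<Longrightarrow> rival G i w = rival G' i w'"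
  unfolding rival_def by (intro arg_cong[where f = Max] image_cong) auto

lemma smooth_grad_eq:
  "smooth_grad \<beta> \<eta> N G i = noise.prob {w \<in> space noise. rival G i w < G i + \<eta> * w i}"
  unfolding smooth_grad_def rival_less_iff ..

text \<open>Fubini with coordinate \<open>i\<close> integrated innermost, while the rival value is
  frozen. It reduces ties, wins and narrow wins of arm \<open>i\<close> to one-dimensional events
  under \<open>D_beta\<close>.\<close>

lemma emeasure_noise_eq:
  assumes "i < N" and P: "Measurable.pred (borel \<Otimes>\<^sub>M borel) (\<lambda>(z, r). P z r)"
  shows "emeasure noise {w \<in> space noise. P (w i) (rival G i w)}
    = (\<integral>\<^sup>+w. emeasure (D_beta \<beta>) {z. P z (rival G i w)} \<partial>PiM ({..<N} - {i}) (\<lambda>_. D_beta \<beta>))"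
proof -
  let ?J = "{..<N} - {i}"
  have ins: "insert i ?J = {..<N}" using assms by auto
  have "(\<lambda>w. (w i, rival G i w)) \<in> noise \<rightarrow>\<^sub>M borel \<Otimes>\<^sub>M borel"
    using assms by (intro measurable_Pair measurable_component measurable_rival_noise) auto
  from measurable_compose[OF this P]
  have meas: "{w \<in> space noise. P (w i) (rival G i w)} \<in> sets noise"
    by (simp add: pred_def)
  have "(\<lambda>z. (z, r)) \<in> borel \<rightarrow>\<^sub>M borel \<Otimes>\<^sub>M borel" for r :: real
    by simp
  from measurable_compose[OF this P]
  have measP: "{z. P z r} \<in> sets borel" for r
    by (simp add: pred_def)
  let ?S = "{w \<in> space noise. P (w i) (rival G i w)}"
  have "emeasure noise ?S = (\<integral>\<^sup>+w. indicator ?S w \<partial>noise)"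
    using meas by simp
  also have "\<dots> = (\<integral>\<^sup>+w. (\<integral>\<^sup>+z. indicator ?S (w(i := z)) \<partial>D_beta \<beta>) \<partial>PiM ?J (\<lambda>_. D_beta \<beta>))"
    using product_nn_integral_insert[of ?J i "indicator ?S"] meas
    unfolding ins by simp
  also have "\<dots> = (\<integral>\<^sup>+w. (\<integral>\<^sup>+z. indicator {z. P z (rival G i w)} z \<partial>D_beta \<beta>) \<partial>PiM ?J (\<lambda>_. D_beta \<beta>))"
  proof (intro nn_integral_cong)
    fix w z assume w: "w \<in> space (PiM ?J (\<lambda>_. D_beta \<beta>))"
    have "rival G i (w(i := z)) = rival G i w"
      by (rule rival_cong) auto
    moreover have "w(i := z) \<in> space noise"
      using w \<open>i < N\<close> by (auto simp: space_PiM PiE_def extensional_def)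
    ultimately show "indicator ?S (w(i := z)) = (indicator {z. P z (rival G i w)} z :: ennreal)"
      by (auto split: split_indicator)
  qed
  also have "\<dots> = (\<integral>\<^sup>+w. emeasure (D_beta \<beta>) {z. P z (rival G i w)} \<partial>PiM ?J (\<lambda>_. D_beta \<beta>))"
    by (intro nn_integral_cong nn_integral_indicator) (simp add: measP)
  finally show ?thesis .
qed

lemma noise_component:
  fixes h :: "real \<Rightarrow> real"
  assumes "j < N" "integrable (D_beta \<beta>) h"
  shows "integrable noise (\<lambda>w. h (w j))"
    and "(\<integral>w. h (w j) \<partial>noise) = (\<integral>z. h z \<partial>D_beta \<beta>)"
proof -
  have d: "distr noise (D_beta \<beta>) (\<lambda>w. w j) = D_beta \<beta>"
    using assms D.prob_space_axioms by (intro distr_PiM_component) auto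
  have m: "(\<lambda>w. w j) \<in> noise \<rightarrow>\<^sub>M D_beta \<beta>"
    using assms by (intro measurable_component_singleton) auto
  show "integrable noise (\<lambda>w. h (w j))"
    using integrable_distr[OF m, of h] assms by (simp add: d)
  show "(\<integral>w. h (w j) \<partial>noise) = (\<integral>z. h z \<partial>D_beta \<beta>)"
    using integral_distr[OF m, of h] assms by (simp add: d)
qed

section \<open>Integrability and size of the potential\<close>

lemma arms_nonempty: "{..<N} \<noteq> {}"
  using N_ge_2 by (simp add: lessThan_empty_iff)

lemma integrable_Max_noise:
  "integrable noise (\<lambda>w. Max ((\<lambda>j. G j + \<eta> * w j) ` {..<N}))"
proof (rule Bochner_Integration.integrable_bound)
  have id: "integrable (D_beta \<beta>) (\<lambda>z. z)"
    using \<beta>_gt_1 by (intro integrable_id_D_beta) simp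
  show "integrable noise (\<lambda>w. \<Sum>j<N. \<bar>G j + \<eta> * w j\<bar>)"
    by (intro Bochner_Integration.integrable_sum integrable_abs Bochner_Integration.integrable_add
        integrable_mult_right noise_component(1)[OF _ id]) auto
  show "(\<lambda>w. Max ((\<lambda>j. G j + \<eta> * w j) ` {..<N})) \<in> borel_measurable noise"
    by (intro borel_measurable_Max borel_measurable_add borel_measurable_times
        measurable_component borel_measurable_const) auto
  have "\<bar>Max ((\<lambda>j. G j + \<eta> * w j) ` {..<N})\<bar> \<le> (\<Sum>j<N. \<bar>G j + \<eta> * w j\<bar>)" for w
  proof -
    have "Max ((\<lambda>j. G j + \<eta> * w j) ` {..<N}) \<in> (\<lambda>j. G j + \<eta> * w j) ` {..<N}"
      using arms_nonempty by (intro Max_in) auto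
    then obtain j where "j < N" "Max ((\<lambda>j. G j + \<eta> * w j) ` {..<N}) = G j + \<eta> * w j"
      by blast
    then show ?thesis
      using member_le_sum[of j "{..<N}" "\<lambda>j. \<bar>G j + \<eta> * w j\<bar>"] by simp
  qed
  then show "AE w in noise. norm (Max ((\<lambda>j. G j + \<eta> * w j) ` {..<N})) \<le> norm (\<Sum>j<N. \<bar>G j + \<eta> * w j\<bar>)"
    by (intro AE_I2) (simp add: order_trans[OF _ abs_ge_self])
qed

lemma AE_noise_nonneg: "j < N \<Longrightarrow> AE w in noise. 0 \<le> w j"
  using AE_D_beta_nonneg D.prob_space_axioms by (intro AE_PiM_component) auto

text \<open>The noise is almost surely nonnegative, so smoothing never underestimates an arm and no
  penalty for underestimation enters the regret.\<close>

lemma potential_ge: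
  assumes "j < N"
  shows "G j \<le> potential G"
proof -
  have "(\<integral>w. G j \<partial>noise) \<le> potential G"
    unfolding potential_def
  proof (rule integral_mono_AE)
    show "AE w in noise. G j \<le> Max ((\<lambda>j. G j + \<eta> * w j) ` {..<N})"
      using AE_noise_nonneg[OF assms]
    proof eventually_elim
      case (elim w)
      have "G j + \<eta> * w j \<le> Max ((\<lambda>j. G j + \<eta> * w j) ` {..<N})"
        using assms by (intro Max_ge) auto
      moreover have "0 \<le> \<eta> * w j"
        using elim \<eta>_pos by simp
      ultimately show ?case by linarith
    qed
  qed (use integrable_Max_noise in auto)
  then show ?thesis by (simp add: noise.prob_space)
qed

text \<open>A Chernoff-type bound: \<open>z / 2 \<le> ln N + exp (z / 2 - ln N)\<close>, and the last term, summed over the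
  arms, has bounded expectation.\<close>
lemma potential_zero_le:
  "potential (\<lambda>_. 0) \<le> 2 * \<eta> * (ln N + (\<integral>z. exp (z / 2) \<partial>D_beta \<beta>))"
proof -
  define K where "K = (\<integral>z. exp (z / 2) \<partial>D_beta \<beta>)"
  have int: "integrable (D_beta \<beta>) (\<lambda>z. exp (z / 2))"
    using integrable_exp_D_beta[of \<beta> "1/2"] \<beta>_gt_1 by simp
  have N: "0 < real N" using N_ge_2 by simp
  let ?R = "\<lambda>w. 2 * \<eta> * (ln N + (\<Sum>j<N. exp (w j / 2)) / N)"
  have intR: "integrable noise (\<lambda>w. \<Sum>j<N. exp (w j / 2))"
    by (intro Bochner_Integration.integrable_sum noise_component(1)[OF _ int]) auto
  have "potential (\<lambda>_. 0) \<le> (\<integral>w. ?R w \<partial>noise)"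
    unfolding potential_def
  proof (rule integral_mono)
    show "integrable noise ?R"
      by (intro integrable_mult_right Bochner_Integration.integrable_add integrable_divide intR) auto
    fix w
    have "0 + \<eta> * w j \<le> ?R w" if j: "j < N" for j
    proof -
      have "w j / 2 - ln N \<le> exp (w j / 2 - ln N)"
        using exp_ge_add_one_self[of "w j / 2 - ln N"] by linarith
      also have "\<dots> = exp (w j / 2) / N"
        using N by (simp add: exp_diff)
      also have "\<dots> \<le> (\<Sum>j<N. exp (w j / 2)) / N"
        using j by (intro divide_right_mono member_le_sum) auto
      finally have "w j \<le> 2 * (ln N + (\<Sum>j<N. exp (w j / 2)) / N)" by simp
      then have "\<eta> * w j \<le> \<eta> * (2 * (ln N + (\<Sum>j<N. exp (w j / 2)) / N))"
        using \<eta>_pos by (intro mult_left_mono) auto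
      then show ?thesis by (simp add: mult_ac)
    qed
    then show "Max ((\<lambda>j. 0 + \<eta> * w j) ` {..<N}) \<le> ?R w"
      using arms_nonempty by (intro Max.boundedI) auto
  qed (rule integrable_Max_noise)
  also have "\<dots> = 2 * \<eta> * (ln N + (\<integral>w. (\<Sum>j<N. exp (w j / 2)) \<partial>noise) / N)"
    using intR by (simp add: noise.prob_space)
  also have "(\<integral>w. (\<Sum>j<N. exp (w j / 2)) \<partial>noise) = (\<Sum>j<N. K)"
    unfolding K_def using noise_component[OF _ int]
    by (subst Bochner_Integration.integral_sum) auto
  also have "(\<Sum>j<N. K) / N = K"
    using N by simp
  finally show ?thesis unfolding K_def .
qed

section \<open>Winning probabilities and the error in one step\<close>

lemma sets_noise_rival:
  assumes "i < N"
  shows "{w \<in> space noise. rival G i w < G i + \<eta> * w i} \<in> sets noise" (is ?A)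
    and "{w \<in> space noise. rival G i w < G i + \<eta> * w i \<and> G i + \<eta> * w i < rival G i w + s} \<in> sets noise" (is ?B)
proof -
  have X: "(\<lambda>w. G i + \<eta> * w i) \<in> borel_measurable noise"
    using assms by (intro borel_measurable_add borel_measurable_times
        measurable_component borel_measurable_const) auto
  show ?A
    by (intro borel_measurable_less measurable_rival_noise X)
  have "{w \<in> space noise. G i + \<eta> * w i < rival G i w + s} \<in> sets noise"
    by (intro borel_measurable_less borel_measurable_add measurable_rival_noise X borel_measurable_const)
  from sets.Int[OF \<open>?A\<close> this] show ?B
    by (rule back_subst[where P = "\<lambda>S. S \<in> sets noise"]) auto
qed

text \<open>For a frozen rival value a tie forces \<open>w i\<close> to be one particular number,
  and \<open>D_beta\<close> has no atoms.\<close>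

lemma AE_rival_neq:
  assumes "i < N"
  shows "AE w in noise. rival G i w \<noteq> G i + \<eta> * w i"
proof -
  have "Measurable.pred (borel \<Otimes>\<^sub>M borel) (\<lambda>(z, r). r = G i + \<eta> * z)"
    by measurable
  from emeasure_noise_eq[OF assms this, of G]
  have "emeasure noise {w \<in> space noise. rival G i w = G i + \<eta> * w i}
    = (\<integral>\<^sup>+w. emeasure (D_beta \<beta>) {z. rival G i w = G i + \<eta> * z} \<partial>PiM ({..<N} - {i}) (\<lambda>_. D_beta \<beta>))" .
  also have "\<dots> = (\<integral>\<^sup>+w. 0 \<partial>PiM ({..<N} - {i}) (\<lambda>_. D_beta \<beta>))"
  proof (rule nn_integral_cong)
    fix w
    have "{z. rival G i w = G i + \<eta> * z} = {(rival G i w - G i) / \<eta>}"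
      using \<eta>_pos by (auto simp: field_simps)
    then show "emeasure (D_beta \<beta>) {z. rival G i w = G i + \<eta> * z} = 0"
      by simp
  qed
  finally have "emeasure noise {w \<in> space noise. rival G i w = G i + \<eta> * w i} = 0"
    by simp
  moreover have "{w \<in> space noise. rival G i w = G i + \<eta> * w i} \<in> sets noise"
    using assms by (intro borel_measurable_eq borel_measurable_add borel_measurable_times
        measurable_component borel_measurable_const measurable_rival_noise) auto
  ultimately show ?thesis
    by (intro AE_I[where N = "{w \<in> space noise. rival G i w = G i + \<eta> * w i}"]) auto
qed

lemma smooth_grad_nonneg: "0 \<le> smooth_grad \<beta> \<eta> N G i"
  by (simp add: smooth_grad_def)

text \<open>Strict wins of different arms exclude each other, and together they cover everything but
  the null event of a tie.\<close>

lemma sum_smooth_grad: "(\<Sum>i<N. smooth_grad \<beta> \<eta> N G i) = 1"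
proof -
  let ?W = "\<lambda>i. {w \<in> space noise. rival G i w < G i + \<eta> * w i}"
  have "disjoint_family_on ?W {..<N}"
    unfolding disjoint_family_on_def rival_less_iff by force
  then have "(\<Sum>i<N. noise.prob (?W i)) = noise.prob (\<Union>i<N. ?W i)"
    using sets_noise_rival(1)
    by (intro noise.finite_measure_finite_Union[symmetric]) auto
  also have "\<dots> = 1"
  proof (rule noise.prob_eq_1[THEN iffD2])
    show "(\<Union>i<N. ?W i) \<in> sets noise"
      using sets_noise_rival(1) by auto
    have "AE w in noise. \<forall>i\<in>{..<N}. rival G i w \<noteq> G i + \<eta> * w i"
      using AE_rival_neq by (intro AE_finite_allI) auto
    then show "AE w in noise. w \<in> (\<Union>i<N. ?W i)"
      using AE_space
    proof eventually_elim
      case (elim w)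
      have "Max ((\<lambda>j. G j + \<eta> * w j) ` {..<N}) \<in> (\<lambda>j. G j + \<eta> * w j) ` {..<N}"
        using arms_nonempty by (intro Max_in) auto
      then obtain i where i: "i < N" "Max ((\<lambda>j. G j + \<eta> * w j) ` {..<N}) = G i + \<eta> * w i"
        by blast
      then have "rival G i w \<le> G i + \<eta> * w i"
        using Max_eq_max_rival[OF i(1), of G w] by simp
      then have "rival G i w < G i + \<eta> * w i"
        using elim i by force
      then show ?case using elim i by auto
    qed
  qed
  finally show ?thesis
    by (simp add: smooth_grad_eq)
qed

text \<open>With \<open>X = G i + \<eta> * w i\<close> and \<open>R\<close> the rival value, lowering \<open>X\<close> by \<open>s\<close> lowers
  \<open>max X R\<close> by the full \<open>s\<close> wherever \<open>X > R\<close>, except on the event \<open>R < X < R + s\<close>.\<close>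
lemma potential_decrease:
  assumes i: "i < N" and s: "0 \<le> s"
  shows "potential (\<lambda>j. G j + (if j = i then - s else 0)) - potential G + s * smooth_grad \<beta> \<eta> N G i
    \<le> s * noise.prob {w \<in> space noise. rival G i w < G i + \<eta> * w i \<and> G i + \<eta> * w i < rival G i w + s}"
proof -
  let ?G = "\<lambda>j. G j + (if j = i then - s else 0)"
  let ?W = "{w \<in> space noise. rival G i w < G i + \<eta> * w i}"
  let ?V = "{w \<in> space noise. rival G i w < G i + \<eta> * w i \<and> G i + \<eta> * w i < rival G i w + s}"
  let ?m = "\<lambda>G w. Max ((\<lambda>j. G j + \<eta> * w j) ` {..<N})"
  have intW: "integrable noise (\<lambda>w. s * indicator ?W w :: real)"
    and intV: "integrable noise (\<lambda>w. s * indicator ?V w :: real)"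
    using sets_noise_rival[OF i, of G]
    by (auto intro!: integrable_mult_right integrable_real_indicator simp: less_top[symmetric])
  have "potential ?G - potential G + s * smooth_grad \<beta> \<eta> N G i
      = (\<integral>w. ?m ?G w - ?m G w + s * indicator ?W w \<partial>noise)"
    unfolding potential_def smooth_grad_eq
    using integrable_Max_noise[of ?G] integrable_Max_noise[of G] intW sets_noise_rival(1)[OF i, of G]
    by simp
  also have "\<dots> \<le> (\<integral>w. s * indicator ?V w \<partial>noise)"
  proof (rule integral_mono)
    show "integrable noise (\<lambda>w. ?m ?G w - ?m G w + s * indicator ?W w)"
      by (intro Bochner_Integration.integrable_add Bochner_Integration.integrable_diff
          integrable_Max_noise intW)
    fix w assume w: "w \<in> space noise"
    have "rival ?G i w = rival G i w"
      by (rule rival_cong) auto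
    then have "?m ?G w = max (G i - s + \<eta> * w i) (rival G i w)"
      using Max_eq_max_rival[OF i, of ?G w] by simp
    then show "?m ?G w - ?m G w + s * indicator ?W w \<le> s * indicator ?V w"
      unfolding Max_eq_max_rival[OF i, of G w]
      using w s by (auto simp: max_def split: split_indicator)
  qed (rule intV)
  also have "\<dots> = s * noise.prob ?V"
    using sets_noise_rival(2)[OF i, of G s] by simp
  finally show ?thesis .
qed

text \<open>With the rivals frozen at threshold \<open>a w\<close>, a win of arm \<open>i\<close> is
  the tail beyond \<open>a w\<close> and a narrow win is a window of length
  \<open>s / \<eta>\<close> there. The hypothesis is affine in the tail, so averaging over the
  rivals turns the tail into the winning probability.\<close>

lemma prob_rival_window_le:
  assumes i: "i < N" and s: "0 \<le> s" and c: "0 \<le> c" "0 \<le> d"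
    and D: "\<And>a. D.prob {a<..<a + s / \<eta>} \<le> c * D.prob {a<..} + d"
  shows "noise.prob {w \<in> space noise. rival G i w < G i + \<eta> * w i \<and> G i + \<eta> * w i < rival G i w + s}
    \<le> c * smooth_grad \<beta> \<eta> N G i + d"
proof -
  let ?O = "PiM ({..<N} - {i}) (\<lambda>_. D_beta \<beta>)"
  let ?W = "{w \<in> space noise. rival G i w < G i + \<eta> * w i}"
  let ?V = "{w \<in> space noise. rival G i w < G i + \<eta> * w i \<and> G i + \<eta> * w i < rival G i w + s}"
  define a where "a w = (rival G i w - G i) / \<eta>" for w
  interpret others: prob_space ?O
    by (intro prob_space_PiM D.prob_space_axioms)
  have "Measurable.pred (borel \<Otimes>\<^sub>M borel) (\<lambda>(z, r). r < G i + \<eta> * z)"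
    by measurable
  from emeasure_noise_eq[OF i this, of G]
  have W: "emeasure noise ?W = (\<integral>\<^sup>+w. emeasure (D_beta \<beta>) {z. rival G i w < G i + \<eta> * z} \<partial>?O)" .
  have "Measurable.pred (borel \<Otimes>\<^sub>M borel) (\<lambda>(z, r). r < G i + \<eta> * z \<and> G i + \<eta> * z < r + s)"
    by measurable
  from emeasure_noise_eq[OF i this, of G]
  have V: "emeasure noise ?V
    = (\<integral>\<^sup>+w. emeasure (D_beta \<beta>) {z. rival G i w < G i + \<eta> * z \<and> G i + \<eta> * z < rival G i w + s} \<partial>?O)" .
  have Wset: "{z. rival G i w < G i + \<eta> * z} = {a w<..}" for w
    using \<eta>_pos by (auto simp: a_def field_simps)
  have Vset: "{z. rival G i w < G i + \<eta> * z \<and> G i + \<eta> * z < rival G i w + s} = {a w<..<a w + s / \<eta>}" for w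
    using \<eta>_pos by (auto simp: a_def field_simps)
  have a [measurable]: "a \<in> borel_measurable ?O"
    unfolding a_def by measurable
  have meas: "(\<lambda>w. D.prob {a w<..}) \<in> borel_measurable ?O"
  proof -
    \<comment> \<open>The tail is nonincreasing, so measurability is obtained from its
      negation.\<close>
    have "mono (\<lambda>x. - D.prob {x<..})"
      by (intro monoI) (auto intro!: D.finite_measure_mono)
    from measurable_compose[OF a borel_measurable_mono[OF this]]
    show ?thesis by simp
  qed
  have "ennreal (noise.prob ?V) = (\<integral>\<^sup>+w. ennreal (D.prob {a w<..<a w + s / \<eta>}) \<partial>?O)"
    using V unfolding Vset noise.emeasure_eq_measure D.emeasure_eq_measure .
  also have "\<dots> \<le> (\<integral>\<^sup>+w. ennreal c * ennreal (D.prob {a w<..}) + ennreal d \<partial>?O)"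
    using c by (intro nn_integral_mono)
      (simp add: ennreal_mult[symmetric] ennreal_plus[symmetric] D del: ennreal_plus)
  also have "\<dots> = ennreal c * (\<integral>\<^sup>+w. ennreal (D.prob {a w<..}) \<partial>?O) + ennreal d"
    using meas by (simp add: nn_integral_add nn_integral_cmult others.emeasure_space_1)
  also have "(\<integral>\<^sup>+w. ennreal (D.prob {a w<..}) \<partial>?O) = ennreal (noise.prob ?W)"
    using W unfolding Wset noise.emeasure_eq_measure D.emeasure_eq_measure ..
  also have "ennreal c * \<dots> + ennreal d = ennreal (c * smooth_grad \<beta> \<eta> N G i + d)"
    using c by (simp add: smooth_grad_eq ennreal_mult)
  finally show ?thesis
    using c smooth_grad_nonneg[of G i] by (subst (asm) ennreal_le_iff) auto
qed

text \<open>Multiplying by \<open>p\<close>, the chance of drawing arm \<open>i\<close>, cancels the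
  importance weight: \<open>p * s = - g \<le> 1\<close>. What is left of the error is the
  probability of a narrow win, which is bounded uniformly in \<open>p\<close>.\<close>

lemma expected_potential_step_arm:
  fixes G :: "nat \<Rightarrow> real" and g B t \<delta> :: real
  assumes i: "i < N" and g: "-1 \<le> g" "g \<le> 0" and B: "0 < B" and t: "0 < t"
    and D: "\<And>a u. 0 \<le> u \<Longrightarrow>
      D.prob {a<..<a+u} \<le> u * (B * (t powr (- \<delta>) * D.prob {a<..} + t powr (1 - \<delta>)))"
  defines "p \<equiv> smooth_grad \<beta> \<eta> N G i"
  shows "p * potential (\<lambda>j. G j + (if j = i then g / p else 0))
    \<le> p * potential G + p * g + (t + 2 * B * t powr (- \<delta>) / \<eta>)"
proof (cases "p = 0")
  case True
  then show ?thesis using t B \<eta>_pos by simp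
next
  case False
  then have p: "0 < p"
    using smooth_grad_nonneg[of G i] by (simp add: p_def)
  define s where "s = - g / p"
  have s: "0 \<le> s" and ps: "p * s = - g" and s1: "s \<le> 1 / p"
    using g p by (auto simp: s_def field_simps)
  let ?V = "noise.prob {w \<in> space noise. rival G i w < G i + \<eta> * w i \<and> G i + \<eta> * w i < rival G i w + s}"
  have "potential (\<lambda>j. G j + (if j = i then g / p else 0)) - potential G + s * p \<le> s * ?V"
  proof -
    have "g / p = - s" by (simp add: s_def)
    then show ?thesis using potential_decrease[OF i s, of G] by (simp add: p_def cong: if_cong)
  qed
  then have "p * (potential (\<lambda>j. G j + (if j = i then g / p else 0)) - potential G + s * p) \<le> p * (s * ?V)"
    using p by (intro mult_left_mono) auto
  then have step: "p * potential (\<lambda>j. G j + (if j = i then g / p else 0))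
      \<le> p * potential G + p * g + - g * ?V"
    using ps by (simp add: algebra_simps flip: mult.assoc)
  have "- g * ?V \<le> 1 * ?V"
    using g by (intro mult_right_mono) auto
  also have "?V \<le> t + 2 * B * t powr (- \<delta>) / \<eta>"
  \<comment> \<open>A narrow win is in particular a win, which settles small \<open>p\<close>. For
    larger \<open>p\<close> the window bound applies, with \<open>s \<le> 1 / p\<close>.\<close>
  proof (cases "p \<le> t")
    case True
    have "?V \<le> p"
      unfolding p_def smooth_grad_eq using sets_noise_rival(1)[OF i, of G]
      by (intro noise.finite_measure_mono) auto
    moreover have "0 \<le> 2 * B * t powr (- \<delta>) / \<eta>"
      using B \<eta>_pos by simp
    ultimately show ?thesis using True by linarith
  next
    case False
    have "?V \<le> (s / \<eta> * B * t powr (- \<delta>)) * p + s / \<eta> * B * t powr (1 - \<delta>)"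
      unfolding p_def
    proof (rule prob_rival_window_le[OF i s])
      show "D.prob {a<..<a + s / \<eta>}
          \<le> s / \<eta> * B * t powr (- \<delta>) * D.prob {a<..} + s / \<eta> * B * t powr (1 - \<delta>)" for a
        using D[of "s / \<eta>" a] s \<eta>_pos by (simp add: algebra_simps)
    qed (use s \<eta>_pos B in auto)
    also have "t powr (1 - \<delta>) = t powr (- \<delta>) * t"
      using t powr_add[of t "- \<delta>" 1] by simp
    also have "s / \<eta> * B * t powr (- \<delta>) * p + s / \<eta> * B * (t powr (- \<delta>) * t)
        = (B * t powr (- \<delta>) / \<eta>) * (s * (p + t))"
      using \<eta>_pos by (simp add: field_simps)
    also have "\<dots> \<le> (B * t powr (- \<delta>) / \<eta>) * 2"
    proof (intro mult_left_mono)
      \<comment> \<open>Here \<open>t < p\<close>, so the constant term of the affine bound costs no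
        more than the linear one.\<close>
      have "s * (p + t) \<le> 1 / p * (p + p)"
        using False s s1 p t by (intro mult_mono) auto
      also have "\<dots> = 2" using p by simp
      finally show "s * (p + t) \<le> 2" .
    qed (use B \<eta>_pos in auto)
    finally show ?thesis using t by (simp add: mult_ac)
  qed
  finally show ?thesis using step by simp
qed

end

section \<open>Sequences of play\<close>

text \<open>The estimate after \<open>n\<close> rounds depends on the history only, so changing a
  later draw leaves it alone.\<close>

lemma gbpa_est_cong:
  assumes "\<And>t. t \<in> {1..n} \<Longrightarrow> I t = I' t"
  shows "gbpa_est \<beta> \<eta> N g I n = gbpa_est \<beta> \<eta> N g I' n"
  using assms
proof (induction n)
  case (Suc n)
  then have "gbpa_est \<beta> \<eta> N g I n = gbpa_est \<beta> \<eta> N g I' n" "I (Suc n) = I' (Suc n)"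
    by auto
  then show ?case by (simp cong: if_cong)
qed simp

text \<open>The weights of the regret with its payoff replaced by an arbitrary functional
  \<open>F\<close> of the draws, so that estimates and potentials can be averaged under the same
  law.\<close>

definition play_expectation ::
  "real \<Rightarrow> real \<Rightarrow> nat \<Rightarrow> (nat \<Rightarrow> nat \<Rightarrow> real) \<Rightarrow> nat \<Rightarrow> ((nat \<Rightarrow> nat) \<Rightarrow> real) \<Rightarrow> real" where
  "play_expectation \<beta> \<eta> N g T F =
     (\<Sum>I\<in>PiE {1..T} (\<lambda>_. {..<N}).
        (\<Prod>t\<in>{1..T}. smooth_grad \<beta> \<eta> N (gbpa_est \<beta> \<eta> N g I (t - 1)) (I t)) * F I)"

text \<open>With no rounds the only extensional sequence is \<open>undefined\<close> everywhere, and
  its weight is the empty product.\<close>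

lemma play_expectation_0 [simp]: "play_expectation \<beta> \<eta> N g 0 F = F (\<lambda>_. undefined)"
  by (simp add: play_expectation_def)

text \<open>The tower property: the last draw is averaged first, given the history. Sequences of
  length \<open>Suc T\<close> are split into a history and a last draw.\<close>

lemma play_expectation_Suc:
  "play_expectation \<beta> \<eta> N g (Suc T) F = play_expectation \<beta> \<eta> N g T
     (\<lambda>I. \<Sum>i<N. smooth_grad \<beta> \<eta> N (gbpa_est \<beta> \<eta> N g I T) i * F (I(Suc T := i)))"
proof -
  let ?P = "PiE {1..T} (\<lambda>_. {..<N})"
  define W where "W n I = (\<Prod>t\<in>{1..n}. smooth_grad \<beta> \<eta> N (gbpa_est \<beta> \<eta> N g I (t - 1)) (I t))" for n I
  have W: "W (Suc T) (I(Suc T := i)) = W T I * smooth_grad \<beta> \<eta> N (gbpa_est \<beta> \<eta> N g I T) i" for I i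
  proof -
    have est: "gbpa_est \<beta> \<eta> N g (I(Suc T := i)) n = gbpa_est \<beta> \<eta> N g I n" if "n \<le> T" for n
      using that by (intro gbpa_est_cong) auto
    have "W T (I(Suc T := i)) = W T I"
      unfolding W_def by (intro prod.cong) (auto simp: est)
    then show ?thesis
      by (simp add: W_def est)
  qed
  have ins: "{1..Suc T} = insert (Suc T) {1..T}"
    by auto
  have "play_expectation \<beta> \<eta> N g (Suc T) F = (\<Sum>I\<in>PiE (insert (Suc T) {1..T}) (\<lambda>_. {..<N}). W (Suc T) I * F I)"
    unfolding play_expectation_def W_def ins ..
  also have "\<dots> = (\<Sum>(i, I)\<in>{..<N} \<times> ?P. W (Suc T) (I(Suc T := i)) * F (I(Suc T := i)))"
    unfolding PiE_insert_eq
    by (subst sum.reindex) (auto intro!: inj_combinator sum.cong simp del: One_nat_def)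
  also have "\<dots> = (\<Sum>I\<in>?P. \<Sum>i<N. W (Suc T) (I(Suc T := i)) * F (I(Suc T := i)))"
    by (subst sum.swap) (simp add: sum.cartesian_product)
  also have "\<dots> = play_expectation \<beta> \<eta> N g T
     (\<lambda>I. \<Sum>i<N. smooth_grad \<beta> \<eta> N (gbpa_est \<beta> \<eta> N g I T) i * F (I(Suc T := i)))"
    unfolding play_expectation_def W by (simp add: W_def sum_distrib_left mult_ac)
  finally show ?thesis .
qed

lemma play_expectation_mono:
  assumes "\<And>I. I \<in> PiE {1..T} (\<lambda>_. {..<N}) \<Longrightarrow> F I \<le> F' I"
  shows "play_expectation \<beta> \<eta> N g T F \<le> play_expectation \<beta> \<eta> N g T F'"
  unfolding play_expectation_def
  by (intro sum_mono mult_left_mono prod_nonneg assms) (auto simp: smooth_grad_def)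

lemma play_expectation_add:
  "play_expectation \<beta> \<eta> N g T (\<lambda>I. F I + F' I)
    = play_expectation \<beta> \<eta> N g T F + play_expectation \<beta> \<eta> N g T F'"
  by (simp add: play_expectation_def algebra_simps sum.distrib)

lemma gbpa_expected_regret_eq:
  "gbpa_expected_regret \<beta> \<eta> N T g
    = play_expectation \<beta> \<eta> N g T (\<lambda>I. Max ((\<lambda>i. \<Sum>t\<in>{1..T}. g t i - g t (I t)) ` {..<N}))"
  by (simp add: gbpa_expected_regret_def play_expectation_def)

section \<open>From one round to the regret\<close>

context smoothed_potential
begin

abbreviation expect where "expect \<equiv> play_expectation \<beta> \<eta> N"
abbreviation est where "est \<equiv> gbpa_est \<beta> \<eta> N"
abbreviation grad where "grad \<equiv> smooth_grad \<beta> \<eta> N"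

lemma expect_const [simp]: "expect g T (\<lambda>_. c) = c"
  by (induction T) (simp_all add: play_expectation_Suc sum_smooth_grad flip: sum_distrib_right)

text \<open>The importance-weighted estimate is unbiased wherever an arm has positive probability.
  Otherwise its increment is 0, which is still at least the nonpositive gain; hence an inequality,
  in the direction the regret bound requires.\<close>

lemma expect_est_ge:
  assumes "i < N" "\<And>t. t \<in> {1..T} \<Longrightarrow> g t i \<le> 0"
  shows "(\<Sum>t\<in>{1..T}. g t i) \<le> expect g T (\<lambda>I. est g I T i)"
  using assms(2)
proof (induction T)
  case (Suc T)
  have "(\<Sum>t\<in>{1..Suc T}. g t i) \<le> expect g T (\<lambda>I. est g I T i) + expect g T (\<lambda>_. g (Suc T) i)"
    using Suc by simp
  also have "\<dots> = expect g T (\<lambda>I. est g I T i + g (Suc T) i)"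
    by (simp only: play_expectation_add)
  also have "\<dots> \<le> expect g T (\<lambda>I. \<Sum>k<N. grad (est g I T) k * est g (I(Suc T := k)) (Suc T) i)"
  proof (rule play_expectation_mono)
    fix I
    let ?p = "grad (est g I T)"
    have est: "est g (I(Suc T := k)) T = est g I T" for k
      by (rule gbpa_est_cong) auto
    have "(\<Sum>k<N. ?p k * est g (I(Suc T := k)) (Suc T) i)
        = (\<Sum>k<N. ?p k * est g I T i + (if i = k then ?p i * (g (Suc T) i / ?p i) else 0))"
      by (intro sum.cong) (auto simp: est Let_def algebra_simps)
    also have "\<dots> = est g I T i + ?p i * (g (Suc T) i / ?p i)"
      using assms(1) by (simp add: sum.distrib sum_smooth_grad flip: sum_distrib_right)
    finally show "est g I T i + g (Suc T) i \<le> (\<Sum>k<N. ?p k * est g (I(Suc T := k)) (Suc T) i)"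
      \<comment> \<open>In the case of zero probability the quotient vanishes by convention, and the
        sign of the gain is used.\<close>
      using Suc.prems[of "Suc T"] by (cases "?p i = 0") auto
  qed
  finally show ?case by (simp only: play_expectation_Suc)
qed simp

text \<open>Induction over the rounds. Summing the one-arm bounds over all arms turns the weights
  into 1 and the drift into the expected gain of the draw, leaving \<open>N * \<kappa>\<close> per
  round.\<close>

lemma expect_potential_le:
  assumes step: "\<And>G i x. i < N \<Longrightarrow> -1 \<le> x \<Longrightarrow> x \<le> 0 \<Longrightarrow>
      grad G i * potential (\<lambda>j. G j + (if j = i then x / grad G i else 0))
        \<le> grad G i * potential G + grad G i * x + \<kappa>"
    and g: "\<And>t i. t \<in> {1..T} \<Longrightarrow> i < N \<Longrightarrow> -1 \<le> g t i \<and> g t i \<le> 0"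
  shows "expect g T (\<lambda>I. potential (est g I T) - (\<Sum>t\<in>{1..T}. g t (I t)))
    \<le> potential (\<lambda>_. 0) + real T * real N * \<kappa>"
  using g
proof (induction T)
  case (Suc T)
  let ?S = "\<lambda>I. \<Sum>t\<in>{1..T}. g t (I t)"
  have "expect g (Suc T) (\<lambda>I. potential (est g I (Suc T)) - (\<Sum>t\<in>{1..Suc T}. g t (I t)))
      \<le> expect g T (\<lambda>I. (potential (est g I T) - ?S I) + N * \<kappa>)"
    unfolding play_expectation_Suc
  proof (rule play_expectation_mono)
    fix I
    let ?G = "est g I T"
    let ?p = "grad ?G"
    have est: "est g (I(Suc T := k)) T = ?G" for k
      by (rule gbpa_est_cong) auto
    have S: "(\<Sum>t\<in>{1..Suc T}. g t ((I(Suc T := k)) t)) = ?S I + g (Suc T) k" for k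
      by simp
    have "(\<Sum>k<N. ?p k * (potential (est g (I(Suc T := k)) (Suc T)) - (\<Sum>t\<in>{1..Suc T}. g t ((I(Suc T := k)) t))))
        \<le> (\<Sum>k<N. ?p k * (potential ?G - ?S I) + \<kappa>)"
    proof (rule sum_mono)
      fix k assume "k \<in> {..<N}"
      then have "?p k * potential (\<lambda>j. ?G j + (if j = k then g (Suc T) k / ?p k else 0))
          \<le> ?p k * potential ?G + ?p k * g (Suc T) k + \<kappa>"
        using Suc.prems[of "Suc T" k] by (intro step) auto
      moreover have "est g (I(Suc T := k)) (Suc T) = (\<lambda>j. ?G j + (if j = k then g (Suc T) k / ?p k else 0))"
        by (simp add: est Let_def cong: if_cong)
      ultimately show "?p k * (potential (est g (I(Suc T := k)) (Suc T)) - (\<Sum>t\<in>{1..Suc T}. g t ((I(Suc T := k)) t)))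
          \<le> ?p k * (potential ?G - ?S I) + \<kappa>"
        unfolding S by (simp add: algebra_simps)
    qed
    also have "\<dots> = (potential ?G - ?S I) + N * \<kappa>"
      by (simp add: sum.distrib sum_smooth_grad flip: sum_distrib_right)
    finally show "(\<Sum>k<N. ?p k * (potential (est g (I(Suc T := k)) (Suc T)) - (\<Sum>t\<in>{1..Suc T}. g t ((I(Suc T := k)) t))))
        \<le> (potential ?G - ?S I) + N * \<kappa>" .
  qed
  also have "\<dots> = expect g T (\<lambda>I. potential (est g I T) - ?S I) + N * \<kappa>"
    by (simp only: play_expectation_add expect_const)
  also have "\<dots> \<le> (potential (\<lambda>_. 0) + real T * real N * \<kappa>) + N * \<kappa>"
    using Suc by auto
  finally show ?case by (simp add: algebra_simps)
qed simp

text \<open>The gains are fixed in advance, so one best arm \<open>b\<close> serves all sequences of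
  draws. Its total gain is at most its expected estimate, which is at most the expected
  potential.\<close>

lemma regret_le:
  assumes step: "\<And>G i x. i < N \<Longrightarrow> -1 \<le> x \<Longrightarrow> x \<le> 0 \<Longrightarrow>
      grad G i * potential (\<lambda>j. G j + (if j = i then x / grad G i else 0))
        \<le> grad G i * potential G + grad G i * x + \<kappa>"
    and g: "\<And>t i. t \<in> {1..T} \<Longrightarrow> i < N \<Longrightarrow> -1 \<le> g t i \<and> g t i \<le> 0"
  shows "gbpa_expected_regret \<beta> \<eta> N T g \<le> potential (\<lambda>_. 0) + real T * real N * \<kappa>"
proof -
  let ?tot = "\<lambda>i. \<Sum>t\<in>{1..T}. g t i"
  let ?S = "\<lambda>I. \<Sum>t\<in>{1..T}. g t (I t)"
  have "Max (?tot ` {..<N}) \<in> ?tot ` {..<N}"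
    using arms_nonempty by (intro Max_in) auto
  then obtain b where b: "b < N" "Max (?tot ` {..<N}) = ?tot b"
    by blast
  then have best: "?tot i \<le> ?tot b" if "i < N" for i
    using Max_ge[of "?tot ` {..<N}" "?tot i"] that by auto
  have "gbpa_expected_regret \<beta> \<eta> N T g \<le> expect g T (\<lambda>I. ?tot b + - ?S I)"
    unfolding gbpa_expected_regret_eq
  proof (rule play_expectation_mono)
    fix I
    show "Max ((\<lambda>i. \<Sum>t\<in>{1..T}. g t i - g t (I t)) ` {..<N}) \<le> ?tot b + - ?S I"
      using arms_nonempty best by (intro Max.boundedI) (auto simp: sum_subtractf)
  qed
  also have "\<dots> = ?tot b + expect g T (\<lambda>I. - ?S I)"
    by (simp only: play_expectation_add expect_const)
  also have "\<dots> \<le> expect g T (\<lambda>I. est g I T b) + expect g T (\<lambda>I. - ?S I)"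
    using b g by (intro add_right_mono expect_est_ge) auto
  also have "\<dots> = expect g T (\<lambda>I. est g I T b + - ?S I)"
    by (simp only: play_expectation_add)
  also have "\<dots> \<le> expect g T (\<lambda>I. potential (est g I T) - ?S I)"
    using potential_ge[OF b(1)] by (intro play_expectation_mono) simp
  also have "\<dots> \<le> potential (\<lambda>_. 0) + real T * real N * \<kappa>"
    using step g by (rule expect_potential_le)
  finally show ?thesis .
qed

end

section \<open>Choice of scale and the final bound\<close>

lemma regret_bound_le_powr:
  fixes x \<eta> n B K \<epsilon> \<delta> :: real
  assumes x: "1 \<le> n" "n \<le> x" and B: "0 \<le> B" and K: "0 \<le> K"
    and \<delta>: "0 < \<delta>" "\<delta> \<le> \<epsilon>" and \<eta>: "\<eta> = x powr (1/2)"
  shows "2 * \<eta> * (ln n + K) + x * (1 / \<eta> + 2 * B * (1 / \<eta>) powr (- \<delta>) / \<eta>)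
    \<le> (2 / \<epsilon> + 2 * K + 1 + 2 * B) * x powr (1/2 + \<epsilon>)"
proof -
  have x1: "1 \<le> x" and \<epsilon>: "0 < \<epsilon>" using x \<delta> by auto
  \<comment> \<open>The logarithm of the number of arms is absorbed by the extra
    \<open>\<epsilon>\<close> in the exponent, at the price of \<open>1 / \<epsilon>\<close> in the
    constant.\<close>
  have "ln n \<le> x powr \<epsilon> / \<epsilon>"
    using ln_powr_bound[OF x1 \<epsilon>] x ln_le_cancel_iff[of n x] by linarith
  moreover have "K * 1 \<le> K * x powr \<epsilon>"
    using x1 K \<epsilon> by (intro mult_left_mono ge_one_powr_ge_zero) auto
  ultimately have "ln n + K \<le> (1 / \<epsilon> + K) * x powr \<epsilon>"
    by (simp add: algebra_simps)
  then have "2 * \<eta> * (ln n + K) \<le> 2 * \<eta> * ((1 / \<epsilon> + K) * x powr \<epsilon>)"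
    using \<eta> by (intro mult_left_mono) auto
  then have 1: "2 * \<eta> * (ln n + K) \<le> (2 / \<epsilon> + 2 * K) * x powr (1/2 + \<epsilon>)"
    using x1 by (simp add: \<eta> powr_add algebra_simps)
  have "x * (1 / \<eta>) = x powr (1/2)"
    using x1 powr_diff[of x 1 "1/2"] by (simp add: \<eta>)
  also have "\<dots> \<le> x powr (1/2 + \<epsilon>)"
    using x1 \<epsilon> by (intro powr_mono) auto
  finally have 2: "x * (1 / \<eta>) \<le> x powr (1/2 + \<epsilon>)" .
  \<comment> \<open>The loss from the unbounded hazard rate is only
    \<open>x powr (\<delta> / 2)\<close>, and \<open>\<delta> / 2 \<le> \<epsilon>\<close>.\<close>
  have "(1 / \<eta>) powr (- \<delta>) = x powr (\<delta> / 2)"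
    using x1 by (simp add: \<eta> powr_powr flip: powr_minus_divide)
  then have "x * (2 * B * (1 / \<eta>) powr (- \<delta>) / \<eta>) = 2 * B * ((x * (1 / \<eta>)) * x powr (\<delta> / 2))"
    by simp
  also have "\<dots> = 2 * B * x powr (1/2 + \<delta> / 2)"
    unfolding \<open>x * (1 / \<eta>) = x powr (1/2)\<close> by (simp add: powr_add)
  also have "\<dots> \<le> 2 * B * x powr (1/2 + \<epsilon>)"
    using x1 \<delta> B by (intro mult_left_mono powr_mono) auto
  finally have 3: "x * (2 * B * (1 / \<eta>) powr (- \<delta>) / \<eta>) \<le> 2 * B * x powr (1/2 + \<epsilon>)" .
  show ?thesis
    using 1 2 3 by (simp add: distrib_left distrib_right)
qed

text \<open>Every draw is arm 0, so each sequence has regret 0. This covers the case without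
  rivals.\<close>

lemma gbpa_expected_regret_single_arm: "gbpa_expected_regret \<beta> \<eta> 1 T g = 0"
proof -
  have "Max ((\<lambda>i. \<Sum>t\<in>{1..T}. g t i - g t (I t)) ` {..<1}) = 0" if "I \<in> PiE {1..T} (\<lambda>_. {..<1::nat})" for I
  proof -
    have "(\<Sum>t\<in>{1..T}. g t 0 - g t (I t)) = 0"
      using that by (intro sum.neutral) (auto simp: PiE_def Pi_def)
    then show ?thesis by (simp add: lessThan_Suc)
  qed
  then show ?thesis
    unfolding gbpa_expected_regret_def by (intro sum.neutral) auto
qed

theorem theorem7:
  fixes \<beta> \<epsilon> :: real
  assumes "\<beta> > 1" and "\<epsilon> > 0"
  shows "\<exists>C::real. \<exists>\<eta>::nat \<Rightarrow> nat \<Rightarrow> real. (\<forall>N T. \<eta> N T > 0) \<and>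
           (\<forall>N T (g::nat \<Rightarrow> nat \<Rightarrow> real). N \<ge> 1 \<longrightarrow> T \<ge> 1 \<longrightarrow>
              (\<forall>t\<in>{1..T}. \<forall>i<N. -1 \<le> g t i \<and> g t i \<le> 0) \<longrightarrow>
              gbpa_expected_regret \<beta> (\<eta> N T) N T g \<le> C * (real T * real N) powr (1/2 + \<epsilon>))"
proof -
  \<comment> \<open>The cap keeps \<open>\<delta>\<close> below 1 when \<open>\<epsilon>\<close> is
    large.\<close>
  define \<delta> where "\<delta> = min \<epsilon> (1/2)"
  have \<delta>: "0 < \<delta>" "\<delta> \<le> \<epsilon>" "\<delta> < 1"
    using assms by (auto simp: \<delta>_def)
  obtain B where B: "0 < B" and D: "\<And>a u t. 0 \<le> u \<Longrightarrow> 0 < t \<Longrightarrow>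
      measure (D_beta \<beta>) {a<..<a+u}
        \<le> u * (B * (t powr (- \<delta>) * measure (D_beta \<beta>) {a<..} + t powr (1 - \<delta>)))"
    using D_beta_interval_le[OF assms(1) \<delta>(1,3)] by blast
  define K where "K = (\<integral>z. exp (z / 2) \<partial>D_beta \<beta>)"
  have K: "0 \<le> K" unfolding K_def by simp
  define C where "C = 2 / \<epsilon> + 2 * K + 1 + 2 * B"
  have C: "0 \<le> C" using K B assms by (simp add: C_def)
  \<comment> \<open>The value 1 for no arms or no rounds only keeps the scale positive; otherwise it
    is \<open>sqrt (T * N)\<close>.\<close>
  define \<eta> :: "nat \<Rightarrow> nat \<Rightarrow> real"
    where "\<eta> N T = (if N = 0 \<or> T = 0 then 1 else (real T * real N) powr (1/2))" for N T
  have \<eta>_pos: "0 < \<eta> N T" for N T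
    by (simp add: \<eta>_def)
  have "gbpa_expected_regret \<beta> (\<eta> N T) N T g \<le> C * (real T * real N) powr (1/2 + \<epsilon>)"
    if NT: "N \<ge> 1" "T \<ge> 1" and g: "\<forall>t\<in>{1..T}. \<forall>i<N. -1 \<le> g t i \<and> g t i \<le> 0" for N T g
  proof (cases "N = 1")
    case True
    then show ?thesis
      using C gbpa_expected_regret_single_arm[of \<beta> "\<eta> N T" T g] by simp
  next
    case False
    interpret smoothed_potential \<beta> "\<eta> N T" N
      using assms NT False \<eta>_pos by unfold_locales auto
    \<comment> \<open>The one-arm error at threshold \<open>t = 1 / \<eta> N T\<close>. As the scale
      is at least 1, the first term is at most \<open>\<eta> N T powr (\<delta> - 1)\<close>, and
      the second is \<open>2 * B\<close> times that power.\<close>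
    let ?\<kappa> = "1 / \<eta> N T + 2 * B * (1 / \<eta> N T) powr (- \<delta>) / \<eta> N T"
    have "gbpa_expected_regret \<beta> (\<eta> N T) N T g \<le> potential (\<lambda>_. 0) + real T * real N * ?\<kappa>"
    proof (rule regret_le)
      fix G i and x :: real assume "i < N" "-1 \<le> x" "x \<le> 0"
      then show "grad G i * potential (\<lambda>j. G j + (if j = i then x / grad G i else 0))
          \<le> grad G i * potential G + grad G i * x + ?\<kappa>"
        using \<eta>_pos B D by (intro expected_potential_step_arm) auto
    qed (use g in auto)
    also have "\<dots> \<le> 2 * \<eta> N T * (ln N + K) + real T * real N * ?\<kappa>"
      using potential_zero_le by (simp add: K_def)
    also have "\<dots> \<le> C * (real T * real N) powr (1/2 + \<epsilon>)"
      unfolding C_def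
    proof (rule regret_bound_le_powr)
      show "real N \<le> real T * real N"
        using NT mult_right_mono[of 1 "real T" "real N"] by simp
    qed (use NT B K \<delta> in \<open>auto simp: \<eta>_def\<close>)
    finally show ?thesis .
  qed
  then show ?thesis
    using \<eta>_pos by (intro exI[of _ C] exI[of _ \<eta>]) auto
qed

end
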